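(* For every positive integer $n$ there is a bijection $\phi'$ between $\mathcal{T}^0_n$ and $\mathcal{S}_n$ such that if $\tau\in\mathcal{T}^0_n$ and $\sigma=\phi'(\tau)$, then $$D(\tau)=D(\sigma).$$ Additionally, if $0$ is in position $k$ of $\tau$, then $\sigma(k)=1$.
   Context: $\mathcal{S}_n$ is the set of permutations of $[n]=\{1,\dots,n\}$. $\mathcal{T}^0_n$ is the set of all sequences of length $n$ obtained by taking the one-line notation $\pi(1)\pi(2)\dots\pi(n)$ of a permutation $\pi\in\mathcal{S}_n$ consisting of a single $n$-cycle and replacing exactly one entry with $0$; for example $\mathcal{T}^0_3=\{031,201,230,012,302,310\}$. For a sequence of integers $a=a_1a_2\dots a_n$ (in particular for a permutation in one-line notation), $D(a)=\{i : 1\le i\le n-1,\ a_i>a_{i+1}\}$. *)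

theory Defs
  imports "HOL-Combinatorics.Combinatorics"
begin

definition one_line :: "nat \<Rightarrow> (nat \<Rightarrow> nat) \<Rightarrow> nat list" where
  "one_line n p = map p [1..<Suc n]"

text \<open>Positions are numbered from 1, while list indices start at 0: the entry \<open>a\<^sub>i\<close> is \<open>a ! (i - 1)\<close>.\<close>

definition descents :: "'a::linorder list \<Rightarrow> nat set" where
  "descents a = {i. 1 \<le> i \<and> i \<le> length a - 1 \<and> a ! (i - 1) > a ! i}"

definition sym_perms :: "nat \<Rightarrow> (nat \<Rightarrow> nat) set" where
  "sym_perms n = {p. p permutes {1..n}}"

text \<open>Being a single \<open>n\<close>-cycle means that all of \<open>{1..n}\<close> is one orbit, so the only
  permutation of \<open>{1}\<close> is a 1-cycle.\<close>

definition cyclic_perms :: "nat \<Rightarrow> (nat \<Rightarrow> nat) set" where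
  "cyclic_perms n = {p \<in> sym_perms n. cyclic_on p {1..n}}"

definition zeroed_cycles :: "nat \<Rightarrow> nat list set" where
  "zeroed_cycles n = {(one_line n p)[k - 1 := 0] | p k. p \<in> cyclic_perms n \<and> k \<in> {1..n}}"

end

theory Submission
  imports Defs "HOL-Library.List_Lexorder"
begin

text \<open>Fix the position \<open>k\<close> of the zero. Both an \<open>n\<close>-cycle \<open>p\<close> and a permutation \<open>\<sigma>\<close> with \<open>\<sigma> k = 1\<close>
  amount to an enumeration \<open>g\<close> of \<open>{1..n}\<close> with \<open>g 1 = k\<close>: take \<open>p (g (t + 1)) = g t\<close> cyclically,
  respectively \<open>\<sigma> = g\<^sup>-\<^sup>1\<close>. Cut \<open>{1..n}\<close> into blocks, one of them \<open>{k}\<close>, and let \<open>f\<close> be the index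
  of the block. Following Gessel and Reutenauer, there is exactly one cycle increasing on the blocks
  for every word \<open>f \<circ> g\<close>: the positions \<open>t\<close> of the word \<open>w\<close> have to be ordered by
  \<open>w\<^sub>t w\<^sub>t\<^sub>-\<^sub>1 \<dots> w\<^sub>1\<close> lexicographically. Likewise there is exactly one \<open>\<sigma>\<close>, given by the
  order of the pairs \<open>(w\<^sub>t, t)\<close>. Hence, for every set \<open>S\<close>, as many cycles as permutations have
  all descents away from \<open>k - 1\<close> and \<open>k\<close> in \<open>S\<close>; by induction on \<open>S\<close> the same holds with
  equality to \<open>S\<close>, while the behaviour at \<open>k - 1\<close> and \<open>k\<close> is forced by the minimal entry at \<open>k\<close>.\<close>

section \<open>Sorting by a key\<close>

text \<open>Since \<open>K\<close> is injective and both orders are linear, \<open>K\<close> and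
  \<open>g\<close> compare positions alike in both directions, so \<open>g t\<close> is the rank of
  \<open>K t\<close>. This is the uniqueness half of \<open>card_keyed\<close>.\<close>

lemma key_monotone_eq_rank:
  fixes K :: "nat \<Rightarrow> 'a::linorder"
  assumes g: "g permutes {1..n}" and inj: "inj_on K {1..n}"
    and mono: "\<And>u v. u \<in> {1..n} \<Longrightarrow> v \<in> {1..n} \<Longrightarrow> K u < K v \<Longrightarrow> g u < g v"
    and t: "t \<in> {1..n}"
  shows "g t = card {u \<in> {1..n}. K u \<le> K t}"
proof -
  have iff: "K u \<le> K t \<longleftrightarrow> g u \<le> g t" if "u \<in> {1..n}" for u
    by (metis inj inj_on_eq_iff leD le_less_linear linorder_le_less_linear mono
        not_less_iff_gr_or_eq order_le_less t that)
  have "g ` {u \<in> {1..n}. g u \<le> g t} = {1..g t}"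
  proof
    show "{1..g t} \<subseteq> g ` {u \<in> {1..n}. g u \<le> g t}"
    proof
      fix x assume x: "x \<in> {1..g t}"
      then have "x \<in> {1..n}" using t permutes_in_image[OF g, of t] by auto
      then obtain u where "u \<in> {1..n}" "x = g u" using permutes_image[OF g] by blast
      then show "x \<in> g ` {u \<in> {1..n}. g u \<le> g t}" using x by auto
    qed
    show "g ` {u \<in> {1..n}. g u \<le> g t} \<subseteq> {1..g t}"
    proof
      fix x assume "x \<in> g ` {u \<in> {1..n}. g u \<le> g t}"
      then obtain u where "x = g u" "u \<in> {1..n}" "g u \<le> g t" by blast
      then show "x \<in> {1..g t}" using permutes_in_image[OF g, of u] by simp
    qed
  qed
  then have "card {u \<in> {1..n}. g u \<le> g t} = g t"
    by (metis card_atLeastAtMost card_image diff_Suc_1 inj_on_subset permutes_inj_on[OF g]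
        subset_UNIV One_nat_def)
  moreover have "{u \<in> {1..n}. K u \<le> K t} = {u \<in> {1..n}. g u \<le> g t}" using iff by blast
  ultimately show ?thesis by simp
qed

text \<open>Let \<open>g t\<close> be the rank of \<open>K t\<close>. Read in key order,
  \<open>f \<circ> h\<close> is weakly increasing and takes the same values, with multiplicity, as
  \<open>f\<close> on \<open>{1..n}\<close>; hence the two agree. This is the existence half of
  \<open>card_keyed\<close>.\<close>

lemma ex_key_monotone:
  fixes f :: "nat \<Rightarrow> nat" and K :: "nat \<Rightarrow> 'a::linorder"
  assumes h: "h permutes {1..n}" and f: "mono_on {1..n} f"
    and inj: "inj_on K {1..n}"
    and compat: "\<And>u v. u \<in> {1..n} \<Longrightarrow> v \<in> {1..n} \<Longrightarrow> K u < K v \<Longrightarrow> f (h u) \<le> f (h v)"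
  obtains g where "g permutes {1..n}" "f \<circ> g = f \<circ> h"
    "\<And>u v. u \<in> {1..n} \<Longrightarrow> v \<in> {1..n} \<Longrightarrow> K u < K v \<Longrightarrow> g u < g v"
proof -
  define R where "R t = {u \<in> {1..n}. K u \<le> K t}" for t
  define g where "g t = (if t \<in> {1..n} then card (R t) else t)" for t
  have finR: "finite (R t)" for t by (simp add: R_def)
  have mono: "g u < g v" if "u \<in> {1..n}" "v \<in> {1..n}" "K u < K v" for u v
  proof -
    have "R u \<subseteq> R v" "v \<in> R v" "v \<notin> R u" using that by (auto simp: R_def)
    then have "R u \<subset> R v" by blast
    then show ?thesis using that psubset_card_mono[OF finR] by (simp add: g_def)
  qed
  have inn: "g t \<in> {1..n}" if "t \<in> {1..n}" for t
  proof -
    have "R t \<noteq> {}" using that by (auto simp: R_def)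
    then have "card (R t) > 0" using finR by (simp add: card_gt_0_iff)
    moreover have "card (R t) \<le> card {1..n}" by (rule card_mono) (auto simp: R_def)
    ultimately show ?thesis using that by (simp add: g_def)
  qed
  have "inj_on g {1..n}"
  proof (rule inj_onI)
    fix u v assume uv: "u \<in> {1..n}" "v \<in> {1..n}" "g u = g v"
    then have "K u = K v" using mono by (metis less_irrefl neqE)
    then show "u = v" using inj uv by (simp add: inj_on_eq_iff)
  qed
  then have "bij_betw g {1..n} {1..n}"
    using inn endo_inj_surj[of "{1..n}" g] by (simp add: bij_betw_def image_subset_iff)
  then have g: "g permutes {1..n}" by (rule bij_imp_permutes) (auto simp: g_def)
  have hin: "h t \<in> {1..n} \<longleftrightarrow> t \<in> {1..n}" for t using permutes_in_image[OF h] .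
  \<comment> \<open>Both \<open>{i. f i \<le> c}\<close> and \<open>{i. f i < c}\<close> are initial segments of \<open>{1..n}\<close>,
    so it suffices to compare their sizes with the rank of \<open>t\<close>.\<close>
  have eq: "f (g t) = f (h t)" if t: "t \<in> {1..n}" for t
  proof (rule antisym)
    show "f (g t) \<le> f (h t)"
    proof (rule ccontr)
      assume "\<not> f (g t) \<le> f (h t)"
      then have less: "f (h t) < f (g t)" by simp
      have "h ` R t \<subseteq> {1..<g t}"
      proof
        fix i assume "i \<in> h ` R t"
        then obtain u where u: "i = h u" "u \<in> {1..n}" "K u \<le> K t" by (auto simp: R_def)
        then have "f i \<le> f (h t)" using compat[of u t] inj t
          by (metis inj_on_eq_iff order_le_less order_refl)
        then have "f i < f (g t)" using less by simp
        then have "\<not> g t \<le> i"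
          using mono_onD[OF f, of "g t" i] inn[OF t] u hin by auto
        then show "i \<in> {1..<g t}" using u hin[of u] by auto
      qed
      then have "card (h ` R t) \<le> g t - 1" using card_mono[of "{1..<g t}"] by fastforce
      moreover have "card (h ` R t) = g t"
        using t by (simp add: card_image permutes_inj_on[OF h] g_def)
      ultimately show False using inn[OF t] by auto
    qed
    show "f (h t) \<le> f (g t)"
    proof (rule ccontr)
      assume "\<not> f (h t) \<le> f (g t)"
      then have less: "f (g t) < f (h t)" by simp
      have "{1..g t} \<subseteq> h ` (R t - {t})"
      proof
        fix i assume i: "i \<in> {1..g t}"
        then have iin: "i \<in> {1..n}" using inn[OF t] by auto
        then obtain u where u: "i = h u" "u \<in> {1..n}" using permutes_image[OF h] by blast
        have "f i \<le> f (g t)" using mono_onD[OF f iin inn[OF t]] i by simp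
        then have "f (h u) < f (h t)" using less u by simp
        then have "K u \<le> K t" "u \<noteq> t" using compat[of t u] t u by force+
        then show "i \<in> h ` (R t - {t})" using u by (auto simp: R_def)
      qed
      then have "g t \<le> card (h ` (R t - {t}))"
        using card_mono[of "h ` (R t - {t})" "{1..g t}"] finR by simp
      also have "\<dots> \<le> card (R t - {t})" by (rule card_image_le) (simp add: finR)
      also have "\<dots> < card (R t)" using t finR by (intro psubset_card_mono) (auto simp: R_def)
      finally show False using t by (simp add: g_def)
    qed
  qed
  have "f \<circ> g = f \<circ> h"
  proof
    fix t show "(f \<circ> g) t = (f \<circ> h) t"
    proof (cases "t \<in> {1..n}")
      case True
      then show ?thesis by (simp only: comp_apply eq)
    next
      case False
      then show ?thesis using permutes_not_in[OF h False] permutes_not_in[OF g False] by simp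
    qed
  qed
  with g mono that show ?thesis by blast
qed

section \<open>Enumerations of an interval starting at a given point\<close>

text \<open>Fixing the first element picks one enumeration out of the \<open>n\<close> rotations
  that describe the same cycle, and makes \<open>inv g\<close> take the value 1 at
  \<open>k\<close>.\<close>

definition rooted :: "nat \<Rightarrow> nat \<Rightarrow> (nat \<Rightarrow> nat) set" where
  "rooted n k = {g. g permutes {1..n} \<and> g 1 = k}"

lemma finite_rooted: "finite (rooted n k)"
  by (rule finite_subset[OF _ finite_permutations[of "{1..n}"]]) (auto simp: rooted_def)

text \<open>The key sees \<open>g\<close> only through the word \<open>f \<circ> g\<close>, so
  members with the same word are sorted by the same key.\<close>

definition keyed :: "((nat \<Rightarrow> nat) \<Rightarrow> nat \<Rightarrow> 'a::linorder) \<Rightarrow> (nat \<Rightarrow> nat) \<Rightarrow> nat \<Rightarrow> nat \<Rightarrow> (nat \<Rightarrow> nat) set" where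
  "keyed K f n k = {g \<in> rooted n k. \<forall>u\<in>{1..n}. \<forall>v\<in>{1..n}. K (f \<circ> g) u < K (f \<circ> g) v \<longrightarrow> g u < g v}"

text \<open>The map from \<open>g\<close> to its word is injective on keyed enumerations by the rank
  formula, and reaches every word because any enumeration can be re-sorted by its key without
  changing its word. The resulting count does not depend on \<open>K\<close>.\<close>

lemma card_keyed:
  fixes K :: "(nat \<Rightarrow> nat) \<Rightarrow> nat \<Rightarrow> 'a::linorder"
  assumes k: "k \<in> {1..n}" and f: "mono_on {1..n} f"
    and single: "\<And>i. i \<in> {1..n} \<Longrightarrow> f i = f k \<Longrightarrow> i = k"
    and inj: "\<And>w. inj_on (K w) {1..n}"
    and compat: "\<And>w u v. u \<in> {1..n} \<Longrightarrow> v \<in> {1..n} \<Longrightarrow> K w u < K w v \<Longrightarrow> w u \<le> w v"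
  shows "card (keyed K f n k) = card ((\<lambda>g. f \<circ> g) ` rooted n k)"
proof (rule bij_betw_same_card[of "\<lambda>g. f \<circ> g"], rule bij_betw_imageI)
  show "inj_on (\<lambda>g. f \<circ> g) (keyed K f n k)"
  proof (rule inj_onI)
    fix g h assume g: "g \<in> keyed K f n k" and h: "h \<in> keyed K f n k" and eq: "f \<circ> g = f \<circ> h"
    show "g = h"
    proof
      fix t show "g t = h t"
      proof (cases "t \<in> {1..n}")
        case True
        have "g t = card {u \<in> {1..n}. K (f \<circ> g) u \<le> K (f \<circ> g) t}"
          using g inj True by (intro key_monotone_eq_rank) (auto simp: keyed_def rooted_def)
        moreover have "h t = card {u \<in> {1..n}. K (f \<circ> h) u \<le> K (f \<circ> h) t}"
          using h inj True by (intro key_monotone_eq_rank) (auto simp: keyed_def rooted_def)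
        ultimately show ?thesis using eq by simp
      next
        case False
        then show ?thesis using g h by (metis (no_types, lifting) keyed_def mem_Collect_eq permutes_not_in rooted_def)
      qed
    qed
  qed
  show "(\<lambda>g. f \<circ> g) ` keyed K f n k = (\<lambda>g. f \<circ> g) ` rooted n k"
  proof
    show "(\<lambda>g. f \<circ> g) ` keyed K f n k \<subseteq> (\<lambda>g. f \<circ> g) ` rooted n k"
      by (auto simp: keyed_def)
    show "(\<lambda>g. f \<circ> g) ` rooted n k \<subseteq> (\<lambda>g. f \<circ> g) ` keyed K f n k"
    proof
      fix w assume "w \<in> (\<lambda>g. f \<circ> g) ` rooted n k"
      then obtain h where h: "h permutes {1..n}" "h 1 = k" "w = f \<circ> h" by (auto simp: rooted_def)
      have c: "f (h u) \<le> f (h v)" if "u \<in> {1..n}" "v \<in> {1..n}" "K w u < K w v" for u v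
        using compat[OF that] h by simp
      obtain g where g: "g permutes {1..n}" "f \<circ> g = f \<circ> h"
        "\<And>u v. u \<in> {1..n} \<Longrightarrow> v \<in> {1..n} \<Longrightarrow> K w u < K w v \<Longrightarrow> g u < g v"
        using ex_key_monotone[OF h(1) f inj c] by blast
      \<comment> \<open>Re-sorting moves elements only within levels of \<open>f\<close>, and the
        level of \<open>k\<close> is \<open>{k}\<close>, so the root survives.\<close>
      have "f (g 1) = f k" using g(2) h(2) by (metis comp_apply)
      moreover have "g 1 \<in> {1..n}" using permutes_in_image[OF g(1)] k by auto
      ultimately have "g 1 = k" using single by blast
      then have "g \<in> keyed K f n k" using g h by (auto simp: keyed_def rooted_def)
      then show "w \<in> (\<lambda>g. f \<circ> g) ` keyed K f n k" using g(2) h(3) by (intro image_eqI[of _ _ g]) simp_all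
    qed
  qed
qed

section \<open>The two keys and monotonicity on the levels of \<open>f\<close>\<close>

definition increasing_on_levels :: "(nat \<Rightarrow> nat) \<Rightarrow> nat \<Rightarrow> (nat \<Rightarrow> nat) \<Rightarrow> bool" where
  "increasing_on_levels f n a \<longleftrightarrow> (\<forall>i\<in>{1..n}. \<forall>j\<in>{1..n}. i < j \<longrightarrow> f i = f j \<longrightarrow> a i < a j)"

lemma increasing_on_levelsD:
  "increasing_on_levels f n a \<Longrightarrow> i \<in> {1..n} \<Longrightarrow> j \<in> {1..n} \<Longrightarrow> i < j \<Longrightarrow> f i = f j \<Longrightarrow> a i < a j"
  by (auto simp: increasing_on_levels_def)

text \<open>A list, so that both keys are compared in the lexicographic order on
  \<open>nat list\<close>; equal letters are ordered from left to right.\<close>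

definition position_key :: "(nat \<Rightarrow> nat) \<Rightarrow> nat \<Rightarrow> nat list" where
  "position_key w t = [w t, t]"

text \<open>The word read backwards from position \<open>t\<close> to position 1. Its length is
  \<open>t\<close>, and dropping the head passes to the key of \<open>t - 1\<close>.\<close>

definition history_key :: "(nat \<Rightarrow> nat) \<Rightarrow> nat \<Rightarrow> nat list" where
  "history_key w t = map w (rev [1..<Suc t])"

lemma history_key_Suc: "history_key w (Suc t) = w (Suc t) # history_key w t"
  by (simp add: history_key_def)

lemma history_key_eq_Cons: "t \<ge> 1 \<Longrightarrow> history_key w t = w t # history_key w (t - 1)"
  using history_key_Suc[of w "t - 1"] by simp

lemma inj_position_key: "inj_on (position_key w) A"
  by (auto simp: inj_on_def position_key_def)

lemma inj_history_key: "inj_on (history_key w) A"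
proof (rule inj_onI)
  fix u v assume "history_key w u = history_key w v"
  then have "length (history_key w u) = length (history_key w v)" by simp
  then show "u = v" by (simp add: history_key_def del: upt_Suc)
qed

text \<open>The shift runs backwards so that, away from the root, one step of the cycle drops the
  head of \<open>history_key\<close>.\<close>

definition rot :: "nat \<Rightarrow> nat \<Rightarrow> nat" where
  "rot n t = (if t \<in> {1..n} then if t = 1 then n else t - 1 else t)"

definition cycle_of_enum :: "nat \<Rightarrow> (nat \<Rightarrow> nat) \<Rightarrow> nat \<Rightarrow> nat" where
  "cycle_of_enum n g = g \<circ> rot n \<circ> inv g"

lemma rot_permutes: "rot n permutes {1..n}"
proof (rule bij_imp_permutes)
  show "bij_betw (rot n) {1..n} {1..n}"
    by (rule bij_betwI[where g = "\<lambda>t. if t = n then 1 else Suc t"])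
      (auto simp: rot_def)
qed (auto simp: rot_def)

lemma cycle_of_enum_permutes: "g permutes {1..n} \<Longrightarrow> cycle_of_enum n g permutes {1..n}"
  unfolding cycle_of_enum_def by (intro permutes_compose permutes_inv rot_permutes)

lemma cycle_of_enum_apply:
  "g permutes {1..n} \<Longrightarrow> cycle_of_enum n g (g t) = g (rot n t)"
  by (simp add: cycle_of_enum_def permutes_inverses)

text \<open>Between different levels the monotone \<open>f\<close> already forces the order. Within
  one level the key compares positions, and these are the values of \<open>inv g\<close>.\<close>

lemma increasing_inv_iff_keyed:
  assumes g: "g \<in> rooted n k" and f: "mono_on {1..n} f"
  shows "increasing_on_levels f n (inv g) \<longleftrightarrow> g \<in> keyed position_key f n k"
proof -
  have p: "g permutes {1..n}" using g by (simp add: rooted_def)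
  have gin: "g u \<in> {1..n} \<longleftrightarrow> u \<in> {1..n}" for u using permutes_in_image[OF p] .
  have iin: "inv g u \<in> {1..n} \<longleftrightarrow> u \<in> {1..n}" for u using permutes_in_image[OF permutes_inv[OF p]] .
  have inv: "g (inv g u) = u" "inv g (g u) = u" for u using permutes_inverses[OF p] by auto
  show ?thesis
  proof
    assume L: "increasing_on_levels f n (inv g)"
    have "g u < g v" if uv: "u \<in> {1..n}" "v \<in> {1..n}" "position_key (f \<circ> g) u < position_key (f \<circ> g) v" for u v
    proof (rule ccontr)
      assume "\<not> g u < g v"
      moreover have "u \<noteq> v" using uv(3) by auto
      then have "g u \<noteq> g v" using inv(2) by metis
      ultimately have less: "g v < g u" by simp
      then have "f (g v) \<le> f (g u)" using mono_onD[OF f, of "g v" "g u"] uv gin by auto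
      then have eq: "f (g u) = f (g v)" "u < v" using uv(3) by (auto simp: position_key_def)
      have "inv g (g v) < inv g (g u)"
        using uv gin less eq(1) by (intro increasing_on_levelsD[OF L]) auto
      then show False using eq inv by simp
    qed
    then show "g \<in> keyed position_key f n k" using g by (simp add: keyed_def)
  next
    assume R: "g \<in> keyed position_key f n k"
    show "increasing_on_levels f n (inv g)"
      unfolding increasing_on_levels_def
    proof (intro ballI impI)
      fix i j assume ij: "i \<in> {1..n}" "j \<in> {1..n}" "i < j" "f i = f j"
      show "inv g i < inv g j"
      proof (rule ccontr)
        assume "\<not> inv g i < inv g j"
        moreover have "inv g i \<noteq> inv g j" using ij inv(1) by (metis less_irrefl)
        ultimately have "position_key (f \<circ> g) (inv g j) < position_key (f \<circ> g) (inv g i)"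
          using ij by (simp add: position_key_def inv)
        then have "g (inv g j) < g (inv g i)" using R ij iin unfolding keyed_def by blast
        then show False using ij inv by simp
      qed
    qed
  qed
qed

text \<open>Within a level the heads of the keys agree, so the keys compare like their tails, which
  belong to the images under the cycle. Unfolding this repeatedly compares whole histories.\<close>

lemma increasing_cycle_iff_keyed:
  assumes g: "g \<in> rooted n k" and f: "mono_on {1..n} f"
    and single: "\<And>i. i \<in> {1..n} \<Longrightarrow> f i = f k \<Longrightarrow> i = k"
  shows "increasing_on_levels f n (cycle_of_enum n g) \<longleftrightarrow> g \<in> keyed history_key f n k"
proof -
  have p: "g permutes {1..n}" and g1: "g 1 = k" using g by (simp_all add: rooted_def)
  have gin: "g u \<in> {1..n} \<longleftrightarrow> u \<in> {1..n}" for u using permutes_in_image[OF p] .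
  have gi: "g u = g v \<longleftrightarrow> u = v" for u v using permutes_inj[OF p] by (simp add: inj_eq)
  have step: "cycle_of_enum n g (g t) = g (t - 1)" if "t \<in> {1..n}" "t \<noteq> 1" for t
    using that by (simp add: cycle_of_enum_apply[OF p] rot_def)
  \<comment> \<open>Position 1 carries \<open>k\<close>, which is alone in its level, so the
    wrap-around of \<open>rot\<close> never enters a comparison within a level.\<close>
  have not1: "u \<noteq> 1 \<and> v \<noteq> 1" if "u \<in> {1..n}" "v \<in> {1..n}" "u \<noteq> v" "f (g u) = f (g v)" for u v
    using that single gin gi g1 by metis
  show ?thesis
  proof
    assume L: "increasing_on_levels f n (cycle_of_enum n g)"
    have "g u < g v" if "u \<in> {1..n}" "v \<in> {1..n}" "history_key (f \<circ> g) u < history_key (f \<circ> g) v" for u v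
      using that
    proof (induction u arbitrary: v)
      case (Suc u)
      have ne: "Suc u \<noteq> v" using Suc.prems(3) by auto
      show ?case
      proof (rule ccontr)
        \<comment> \<open>The wrong order forces equal heads, so the tails are in key order. The
          induction hypothesis then orders the images under the cycle against its increase on the
          level.\<close>
        assume "\<not> g (Suc u) < g v"
        then have less: "g v < g (Suc u)" using ne gi[of "Suc u" v] by linarith
        then have le: "f (g v) \<le> f (g (Suc u))"
          using mono_onD[OF f, of "g v" "g (Suc u)"] Suc.prems(1,2) gin by (simp del: atLeastAtMost_iff)
        have "v \<ge> 1" using Suc.prems(2) by simp
        have "f (g (Suc u)) # history_key (f \<circ> g) u < f (g v) # history_key (f \<circ> g) (v - 1)"
          using Suc.prems(3) unfolding history_key_Suc history_key_eq_Cons[OF \<open>v \<ge> 1\<close>]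
          unfolding comp_apply .
        then have eq: "f (g (Suc u)) = f (g v)"
          and tl: "history_key (f \<circ> g) u < history_key (f \<circ> g) (v - 1)"
          using le unfolding Cons_less_Cons by linarith+
        have n1: "Suc u \<noteq> 1" "v \<noteq> 1" using not1[OF Suc.prems(1,2) ne eq] by auto
        then have "u \<in> {1..n}" "v - 1 \<in> {1..n}" using Suc.prems by auto
        then have "g u < g (v - 1)" using tl by (rule Suc.IH)
        moreover have "g (v - 1) < g u"
          using increasing_on_levelsD[OF L, of "g v" "g (Suc u)"] less eq Suc.prems gin n1
            step[of v] step[of "Suc u"] by auto
        ultimately show False by simp
      qed
    qed simp
    then show "g \<in> keyed history_key f n k" using g by (simp add: keyed_def)
  next
    assume R: "g \<in> keyed history_key f n k"
    show "increasing_on_levels f n (cycle_of_enum n g)"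
      unfolding increasing_on_levels_def
    proof (intro ballI impI)
      fix i j assume ij: "i \<in> {1..n}" "j \<in> {1..n}" "i < j" "f i = f j"
      obtain u where u: "i = g u" "u \<in> {1..n}" using permutes_image[OF p] ij by blast
      obtain v where v: "j = g v" "v \<in> {1..n}" using permutes_image[OF p] ij by blast
      have ne: "u \<noteq> v" using u v ij by auto
      have n1: "u \<noteq> 1" "v \<noteq> 1" using not1[OF u(2) v(2) ne] ij u v by auto
      have "\<not> history_key (f \<circ> g) v < history_key (f \<circ> g) u"
      proof
        assume "history_key (f \<circ> g) v < history_key (f \<circ> g) u"
        then have "g v < g u" using R u(2) v(2) unfolding keyed_def by blast
        then show False using u(1) v(1) ij(3) by simp
      qed
      moreover have "history_key (f \<circ> g) v \<noteq> history_key (f \<circ> g) u"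
        using inj_history_key[of "f \<circ> g" UNIV] ne by (auto dest: injD)
      ultimately have "history_key (f \<circ> g) u < history_key (f \<circ> g) v" by simp
      moreover have "u \<ge> 1" "v \<ge> 1" using u v by auto
      \<comment> \<open>The heads are equal because \<open>f i = f j\<close>, and they
        cancel.\<close>
      ultimately have "history_key (f \<circ> g) (u - 1) < history_key (f \<circ> g) (v - 1)"
        using ij(4) unfolding u(1) v(1) by (simp only: history_key_eq_Cons Cons_less_Cons) simp
      moreover have "u - 1 \<in> {1..n}" "v - 1 \<in> {1..n}" using u v n1 by auto
      ultimately have "g (u - 1) < g (v - 1)" using R unfolding keyed_def by blast
      then show "cycle_of_enum n g i < cycle_of_enum n g j" using u v n1 step by simp
    qed
  qed
qed

text \<open>Both sides count the same set of words \<open>f \<circ> g\<close> with \<open>g\<close>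
  in \<open>rooted n k\<close>.\<close>

lemma card_increasing_on_levels:
  assumes k: "k \<in> {1..n}" and f: "mono_on {1..n} f"
    and single: "\<And>i. i \<in> {1..n} \<Longrightarrow> f i = f k \<Longrightarrow> i = k"
  shows "card {g \<in> rooted n k. increasing_on_levels f n (cycle_of_enum n g)} =
    card {g \<in> rooted n k. increasing_on_levels f n (inv g)}"
proof -
  have "{g \<in> rooted n k. increasing_on_levels f n (cycle_of_enum n g)} = keyed history_key f n k"
    using increasing_cycle_iff_keyed[OF _ f single] by (auto simp: keyed_def)
  moreover have "{g \<in> rooted n k. increasing_on_levels f n (inv g)} = keyed position_key f n k"
    using increasing_inv_iff_keyed[OF _ f] by (auto simp: keyed_def)
  moreover have "card (keyed history_key f n k) = card ((\<lambda>g. f \<circ> g) ` rooted n k)"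
    using k f single inj_history_key
    by (rule card_keyed) (auto simp: history_key_eq_Cons)
  moreover have "card (keyed position_key f n k) = card ((\<lambda>g. f \<circ> g) ` rooted n k)"
    using k f single inj_position_key
    by (rule card_keyed) (auto simp: position_key_def)
  ultimately show ?thesis by simp
qed

section \<open>Descents away from the marked position\<close>

text \<open>The omitted indices are those whose comparison involves the entry at \<open>k\<close>,
  which the zero overwrites.\<close>

definition far_descents :: "nat \<Rightarrow> nat \<Rightarrow> (nat \<Rightarrow> nat) \<Rightarrow> nat set" where
  "far_descents n k a = {i \<in> {1..<n} - {k - 1, k}. a (Suc i) < a i}"

text \<open>An element \<open>m\<close> of \<open>R\<close> is a cut between \<open>m\<close> and
  \<open>m + 1\<close>. Counting the cuts before \<open>i\<close> numbers the blocks, so the levels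
  are the intervals between consecutive cuts.\<close>

lemma increasing_on_levels_iff_no_descent:
  assumes "inj_on a {1..n}"
  shows "increasing_on_levels (\<lambda>i. card (R \<inter> {1..<i})) n a \<longleftrightarrow>
    (\<forall>i\<in>{1..<n} - R. a i < a (Suc i))"
proof -
  have Suc: "R \<inter> {1..<Suc i} = (if i \<in> R then insert i (R \<inter> {1..<i}) else R \<inter> {1..<i})"
    if "i \<ge> 1" for i
    using that by (auto simp: less_Suc_eq)
  show ?thesis
  proof
    assume L: "increasing_on_levels (\<lambda>i. card (R \<inter> {1..<i})) n a"
    show "\<forall>i\<in>{1..<n} - R. a i < a (Suc i)"
    proof
      fix i assume "i \<in> {1..<n} - R"
      then show "a i < a (Suc i)"
        using Suc[of i] by (intro increasing_on_levelsD[OF L]) auto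
    qed
  next
    assume R: "\<forall>i\<in>{1..<n} - R. a i < a (Suc i)"
    show "increasing_on_levels (\<lambda>i. card (R \<inter> {1..<i})) n a"
      unfolding increasing_on_levels_def
    proof (intro ballI impI)
      fix i j assume ij: "i \<in> {1..n}" "j \<in> {1..n}" "i < j"
        "card (R \<inter> {1..<i}) = card (R \<inter> {1..<j})"
      \<comment> \<open>One set contains the other and they have equal size, so no cut lies between
        \<open>i\<close> and \<open>j\<close>.\<close>
      have "R \<inter> {1..<i} = R \<inter> {1..<j}"
        using ij by (intro card_subset_eq) auto
      then have no: "m \<notin> R" if "i \<le> m" "m < j" for m
        using that ij by (metis IntD2 IntI atLeastAtMost_iff atLeastLessThan_iff leD order_trans)
      have "a i < a m" if "i < m" "m \<le> j" for m
        using that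
      proof (induction m)
        case (Suc m)
        have "a m < a (Suc m)" using R no[of m] Suc.prems ij by auto
        then show ?case using Suc by (cases "i = m") auto
      qed simp
      then show "a i < a j" using ij by simp
    qed
  qed
qed

lemma far_descents_subset_iff:
  assumes "inj_on a {1..n}"
  shows "far_descents n k a \<subseteq> S \<longleftrightarrow>
    increasing_on_levels (\<lambda>i. card ((S \<union> {k - 1, k}) \<inter> {1..<i})) n a"
proof -
  have "a i < a (Suc i) \<longleftrightarrow> \<not> a (Suc i) < a i" if "i \<in> {1..<n}" for i
    using inj_onD[OF assms, of i "Suc i"] that by force
  moreover have "far_descents n k a \<subseteq> S \<longleftrightarrow> (\<forall>i\<in>{1..<n} - (S \<union> {k - 1, k}). \<not> a (Suc i) < a i)"
    unfolding far_descents_def by blast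
  ultimately show ?thesis
    unfolding increasing_on_levels_iff_no_descent[OF assms] by blast
qed

text \<open>Descents are permitted exactly at the cuts, which is why the condition is an inclusion.
  The cuts at \<open>k - 1\<close> and \<open>k\<close> make \<open>{k}\<close> a block, as the
  count of words requires.\<close>

lemma card_far_descents_subset:
  assumes k: "k \<in> {1..n}"
  shows "card {g \<in> rooted n k. far_descents n k (cycle_of_enum n g) \<subseteq> S} =
    card {g \<in> rooted n k. far_descents n k (inv g) \<subseteq> S}"
proof -
  let ?R = "S \<union> {k - 1, k}"
  let ?f = "\<lambda>i. card (?R \<inter> {1..<i})"
  have f: "mono_on {1..n} ?f" by (intro mono_onI card_mono) auto
  \<comment> \<open>The block number rises strictly across every cut \<open>m\<close>.\<close>
  have lt: "?f i < ?f j" if "m \<in> ?R" "1 \<le> m" "i \<le> m" "m < j" for i j m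
  proof (intro psubset_card_mono)
    have "m \<in> ?R \<inter> {1..<j}" "m \<notin> ?R \<inter> {1..<i}" using that by auto
    moreover have "?R \<inter> {1..<i} \<subseteq> ?R \<inter> {1..<j}" using that by auto
    ultimately show "?R \<inter> {1..<i} \<subset> ?R \<inter> {1..<j}" by blast
  qed simp
  have single: "i = k" if "i \<in> {1..n}" "?f i = ?f k" for i
  proof (rule ccontr)
    assume "i \<noteq> k"
    then consider "i < k" | "k < i" by linarith
    then show False
    proof cases
      case 1
      then have "?f i < ?f k" using that by (intro lt[of "k - 1"]) auto
      then show ?thesis using that by simp
    next
      case 2
      then have "?f k < ?f i" using k by (intro lt[of k]) auto
      then show ?thesis using that by simp
    qed
  qed
  have c: "inj_on (cycle_of_enum n g) {1..n}" and i: "inj_on (inv g) {1..n}" if "g \<in> rooted n k" for g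
    using that cycle_of_enum_permutes[of g n] permutes_inv[of g "{1..n}"]
    by (auto simp: rooted_def permutes_inj_on)
  have "{g \<in> rooted n k. far_descents n k (cycle_of_enum n g) \<subseteq> S} =
    {g \<in> rooted n k. increasing_on_levels ?f n (cycle_of_enum n g)}"
    using far_descents_subset_iff[OF c] by blast
  moreover have "{g \<in> rooted n k. far_descents n k (inv g) \<subseteq> S} =
    {g \<in> rooted n k. increasing_on_levels ?f n (inv g)}"
    using far_descents_subset_iff[OF i] by blast
  ultimately show ?thesis using card_increasing_on_levels[OF k f single] by simp
qed

section \<open>From equal counts to a bijection\<close>

text \<open>Inversion over the subset lattice: subtract the counts for proper subsets of
  \<open>S\<close>, which agree by induction.\<close>

lemma card_eq_of_card_subset:
  fixes D :: "'a \<Rightarrow> 'c set" and E :: "'b \<Rightarrow> 'c set"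
  assumes A: "finite A" and B: "finite B" and S: "finite S"
    and sub: "\<And>S. card {a \<in> A. D a \<subseteq> S} = card {b \<in> B. E b \<subseteq> S}"
  shows "card {a \<in> A. D a = S} = card {b \<in> B. E b = S}"
  using S
proof (induction S rule: finite_psubset_induct)
  case (psubset S)
  have split: "card {a \<in> X. F a \<subseteq> S} =
      card {a \<in> X. F a = S} + (\<Sum>T\<in>{T. T \<subset> S}. card {a \<in> X. F a = T})"
    if X: "finite X" for X and F :: "'x \<Rightarrow> 'c set"
  proof -
    have fin: "finite {T. T \<subset> S}" by (rule finite_subset[of _ "Pow S"]) (auto simp: psubset)
    have "{a \<in> X. F a \<subseteq> S} = {a \<in> X. F a = S} \<union> (\<Union>T\<in>{T. T \<subset> S}. {a \<in> X. F a = T})" by auto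
    also have "card \<dots> = card {a \<in> X. F a = S} + card (\<Union>T\<in>{T. T \<subset> S}. {a \<in> X. F a = T})"
      using X fin by (intro card_Un_disjoint) auto
    also have "card (\<Union>T\<in>{T. T \<subset> S}. {a \<in> X. F a = T}) = (\<Sum>T\<in>{T. T \<subset> S}. card {a \<in> X. F a = T})"
      using X fin by (intro card_UN_disjoint) auto
    finally show ?thesis .
  qed
  have "(\<Sum>T\<in>{T. T \<subset> S}. card {a \<in> A. D a = T}) = (\<Sum>T\<in>{T. T \<subset> S}. card {b \<in> B. E b = T})"
    using psubset.IH by (intro sum.cong) auto
  then show ?case using split[OF A, of D] split[OF B, of E] sub[of S] by simp
qed

text \<open>Fibres of equal size are matched one by one, and the matchings are glued along
  \<open>h\<close>.\<close>

lemma ex_bij_betw_of_card_fibres: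
  assumes A: "finite A" and B: "finite B"
    and eq: "\<And>y. card {a \<in> A. h a = y} = card {b \<in> B. h' b = y}"
  obtains \<theta> where "bij_betw \<theta> A B" "\<And>a. a \<in> A \<Longrightarrow> h' (\<theta> a) = h a"
proof -
  have "\<exists>\<theta>. bij_betw \<theta> {a \<in> A. h a = y} {b \<in> B. h' b = y}" for y
    using A B eq by (intro finite_same_card_bij) auto
  then obtain \<theta> where \<theta>: "\<And>y. bij_betw (\<theta> y) {a \<in> A. h a = y} {b \<in> B. h' b = y}" by metis
  have im: "\<theta> (h a) a \<in> B \<and> h' (\<theta> (h a) a) = h a" if "a \<in> A" for a
    using bij_betwE[OF \<theta>[of "h a"]] that by blast
  have "bij_betw (\<lambda>a. \<theta> (h a) a) A B"
  proof (rule bij_betw_imageI)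
    show "inj_on (\<lambda>a. \<theta> (h a) a) A"
    proof (rule inj_onI)
      fix x y assume xy: "x \<in> A" "y \<in> A" "\<theta> (h x) x = \<theta> (h y) y"
      then have "h x = h y" using im by metis
      then show "x = y" using bij_betw_imp_inj_on[OF \<theta>[of "h x"]] xy by (auto dest: inj_onD)
    qed
    show "(\<lambda>a. \<theta> (h a) a) ` A = B"
    proof
      show "(\<lambda>a. \<theta> (h a) a) ` A \<subseteq> B" using im by blast
      show "B \<subseteq> (\<lambda>a. \<theta> (h a) a) ` A"
      proof
        fix b assume "b \<in> B"
        then have "b \<in> \<theta> (h' b) ` {a \<in> A. h a = h' b}"
          using bij_betw_imp_surj_on[OF \<theta>[of "h' b"]] by blast
        then show "b \<in> (\<lambda>a. \<theta> (h a) a) ` A" by (auto intro!: image_eqI)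
      qed
    qed
  qed
  then show ?thesis using im that by blast
qed

lemma ex_bij_rooted:
  assumes "k \<in> {1..n}"
  obtains \<psi> where "bij_betw \<psi> (rooted n k) (rooted n k)"
    "\<And>g. g \<in> rooted n k \<Longrightarrow> far_descents n k (inv (\<psi> g)) = far_descents n k (cycle_of_enum n g)"
proof (rule ex_bij_betw_of_card_fibres[OF finite_rooted finite_rooted])
  fix S
  show "card {g \<in> rooted n k. far_descents n k (cycle_of_enum n g) = S} =
    card {g \<in> rooted n k. far_descents n k (inv g) = S}"
  proof (cases "finite S")
    case True
    then show ?thesis
      using finite_rooted finite_rooted card_far_descents_subset[OF assms]
      by (intro card_eq_of_card_subset)
  next
    case False
    \<comment> \<open>Descent sets are finite, so both fibres over an infinite \<open>S\<close> are
      empty.\<close>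
    then have "far_descents n k a \<noteq> S" for a by (auto simp: far_descents_def)
    then show ?thesis by simp
  qed
qed (use that in blast)

section \<open>Cycles as enumerations\<close>

text \<open>Iteration from \<open>k\<close> visits \<open>g n\<close>, \<open>g (n - 1)\<close> and
  so on down to \<open>g 1\<close>.\<close>

lemma cyclic_on_cycle_of_enum:
  assumes g: "g \<in> rooted n k" and k: "k \<in> {1..n}"
  shows "cyclic_on (cycle_of_enum n g) {1..n}"
proof -
  have p: "g permutes {1..n}" and g1: "g 1 = k" using g by (simp_all add: rooted_def)
  let ?c = "cycle_of_enum n g"
  \<comment> \<open>An \<open>orbit\<close> is generated from the first image of \<open>k\<close>,
    here \<open>g n\<close>; the root \<open>g 1\<close> itself comes last, at
    \<open>m = n - 1\<close>.\<close>
  have mem: "g (n - m) \<in> orbit ?c k" if "m < n" for m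
    using that
  proof (induction m)
    case 0
    have "?c k = g n" using cycle_of_enum_apply[OF p, of 1] g1 0 by (simp add: rot_def)
    then show ?case by (metis diff_zero orbit.base)
  next
    case (Suc m)
    then have "rot n (n - m) = n - Suc m" by (auto simp: rot_def)
    then have "?c (g (n - m)) = g (n - Suc m)" by (simp add: cycle_of_enum_apply[OF p])
    then show ?case using Suc by (metis Suc_lessD orbit.step)
  qed
  have "{1..n} \<subseteq> orbit ?c k"
  proof
    fix i assume "i \<in> {1..n}"
    then obtain t where "i = g t" "t \<in> {1..n}" using permutes_image[OF p] by blast
    then show "i \<in> orbit ?c k" using mem[of "n - t"] by auto
  qed
  then have "orbit ?c k = {1..n}"
    using permutes_orbit_subset[OF cycle_of_enum_permutes[OF p] k] by auto
  then show ?thesis using k by (auto simp: cyclic_on_def)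
qed

text \<open>The common root fixes \<open>g 1\<close>, and each later entry is the unique preimage of
  the one before it under the cycle.\<close>

lemma inj_on_cycle_of_enum: "inj_on (cycle_of_enum n) (rooted n k)"
proof (rule inj_onI)
  fix g h assume g: "g \<in> rooted n k" and h: "h \<in> rooted n k"
    and eq: "cycle_of_enum n g = cycle_of_enum n h"
  have p: "g permutes {1..n}" "h permutes {1..n}" using g h by (simp_all add: rooted_def)
  have agree: "Suc t \<le> n \<longrightarrow> g (Suc t) = h (Suc t)" for t
  proof (induction t)
    case 0
    then show ?case using g h by (simp add: rooted_def)
  next
    case (Suc t)
    show ?case
    proof
      assume le: "Suc (Suc t) \<le> n"
      have "cycle_of_enum n g (g (Suc (Suc t))) = cycle_of_enum n h (h (Suc (Suc t)))"
        using Suc le by (simp add: cycle_of_enum_apply[OF p(1)] cycle_of_enum_apply[OF p(2)] rot_def)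
      then show "g (Suc (Suc t)) = h (Suc (Suc t))"
        unfolding eq using permutes_inj[OF cycle_of_enum_permutes[OF p(2)]] by (simp add: inj_eq)
    qed
  qed
  show "g = h"
  proof
    fix t show "g t = h t"
    proof (cases "t \<in> {1..n}")
      case True
      then show ?thesis using agree[of "t - 1"] by simp
    qed (simp add: permutes_not_in[OF p(1)] permutes_not_in[OF p(2)])
  qed
qed

text \<open>The cycle runs backwards through its enumeration, so \<open>g\<close> lists the iterates
  of \<open>p\<close> at \<open>k\<close> with decreasing exponents after the root.\<close>

lemma cycle_of_enum_surj:
  assumes p: "p permutes {1..n}" and cyc: "cyclic_on p {1..n}" and k: "k \<in> {1..n}"
  shows "\<exists>g\<in>rooted n k. cycle_of_enum n g = p"
proof -
  have orb: "orbit p k = {1..n}" using orbit_cyclic_eq3[OF cyc k] .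
  \<comment> \<open>The first return time of \<open>k\<close>, which is the size of its orbit and so
    equals \<open>n\<close>.\<close>
  define d where "d = funpow_dist1 p k k"
  have im: "{1..n} = (\<lambda>m. (p ^^ m) k) ` {0..<d}" and inj: "inj_on (\<lambda>m. (p ^^ m) k) {0..<d}"
    and return: "(p ^^ d) k = k"
    using orbit_conv_funpow_dist1[of k p] inj_on_funpow_dist1[of k p k] funpow_dist1_prop[of k p k] orb k
    unfolding d_def by auto
  have "card {1..n} = d" unfolding im using card_image[OF inj] by simp
  then have d: "d = n" by simp
  \<comment> \<open>The root gets exponent 0 instead of \<open>n\<close>, so that the exponents fill
    \<open>{0..<n}\<close>.\<close>
  define e where "e t = (if t = 1 then 0 else Suc n - t)" for t
  define g where "g t = (if t \<in> {1..n} then (p ^^ e t) k else t)" for t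
  have e: "bij_betw e {1..n} {0..<n}"
    by (rule bij_betwI[where g = "\<lambda>m. if m = 0 then 1 else Suc n - m"])
      (use k in \<open>auto simp: e_def\<close>)
  have "bij_betw ((\<lambda>m. (p ^^ m) k) \<circ> e) {1..n} {1..n}"
    using bij_betw_trans[OF e] inj im d by (metis bij_betw_imageI)
  then have "bij_betw g {1..n} {1..n}"
    by (rule bij_betw_cong[THEN iffD1, rotated]) (simp add: g_def)
  then have gp: "g permutes {1..n}" by (rule bij_imp_permutes) (auto simp: g_def)
  have g1: "g 1 = k" using k by (simp add: g_def e_def)
  \<comment> \<open>As \<open>p ^^ n\<close> fixes \<open>k\<close>, one formula also covers
    \<open>t = 1\<close>.\<close>
  have gt: "g t = (p ^^ (Suc n - t)) k" if "t \<in> {1..n}" for t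
    using that return d by (auto simp: g_def e_def)
  have "cycle_of_enum n g = p"
  proof
    fix i show "cycle_of_enum n g i = p i"
    proof (cases "i \<in> {1..n}")
      case True
      then obtain t where t: "i = g t" "t \<in> {1..n}" using permutes_image[OF gp] by blast
      have c: "cycle_of_enum n g i = g (rot n t)" using t cycle_of_enum_apply[OF gp] by simp
      show ?thesis
      proof (cases "t = 1")
        case True
        then show ?thesis using c t g1 gt[of n] by (simp add: rot_def)
      next
        case False
        then have "Suc n - (t - 1) = Suc (Suc n - t)" using t by auto
        moreover have "t - 1 \<in> {1..n}" using t False by auto
        ultimately have "g (t - 1) = p (g t)" using gt[of t] gt[of "t - 1"] t(2) by simp
        then show ?thesis using c t False by (simp add: rot_def)
      qed
    next
      case False
      then show ?thesis
        using permutes_not_in[OF p] permutes_not_in[OF cycle_of_enum_permutes[OF gp]] by simp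
    qed
  qed
  then show ?thesis using gp g1 by (auto simp: rooted_def)
qed

lemma cycle_of_enum_image:
  assumes "k \<in> {1..n}"
  shows "cycle_of_enum n ` rooted n k = cyclic_perms n"
proof
  show "cycle_of_enum n ` rooted n k \<subseteq> cyclic_perms n"
    using cyclic_on_cycle_of_enum[OF _ assms] cycle_of_enum_permutes
    by (auto simp: cyclic_perms_def sym_perms_def rooted_def)
  show "cyclic_perms n \<subseteq> cycle_of_enum n ` rooted n k"
    using cycle_of_enum_surj[OF _ _ assms] by (fastforce simp: cyclic_perms_def sym_perms_def)
qed

section \<open>Assembling the bijection\<close>

lemma one_line_nth: "i \<in> {1..n} \<Longrightarrow> one_line n p ! (i - 1) = p i"
  by (auto simp: one_line_def nth_append simp del: upt_Suc)

lemma length_one_line [simp]: "length (one_line n p) = n"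
  by (simp add: one_line_def)

lemma zeroed_one_line_nth_eq_0_iff:
  assumes "p permutes {1..n}" "k \<in> {1..n}" "j \<in> {1..n}"
  shows "(one_line n p)[k - 1 := 0] ! (j - 1) = 0 \<longleftrightarrow> j = k"
proof (cases "j = k")
  case False
  then have "k - 1 \<noteq> j - 1" using assms by auto
  then show ?thesis
    using False assms permutes_in_image[OF assms(1), of j] one_line_nth[OF assms(3), of p] by auto
qed (use assms in auto)

text \<open>The value at \<open>k\<close> is the only one left over. Hence the entry erased by the
  zero can be recovered.\<close>

lemma permutes_eqI_off_point:
  assumes p: "p permutes A" and q: "q permutes A" and eq: "\<And>i. i \<in> A - {k} \<Longrightarrow> p i = q i"
  shows "p = q"
proof -
  have off: "p i = q i" if "i \<noteq> k" for i
    using that eq permutes_not_in[OF p] permutes_not_in[OF q] by (metis DiffI singletonD)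
  obtain j where j: "p j = q k" using permutes_surj[OF p] by (metis surjD)
  have "p k = q k"
  proof (cases "j = k")
    case False
    then have "q j = q k" using off j by simp
    then show ?thesis using False permutes_inj[OF q] by (auto dest: injD)
  qed (use j in simp)
  then show ?thesis using off by (intro ext) metis
qed

lemma zeroed_one_line_inj:
  assumes p: "p permutes {1..n}" and q: "q permutes {1..n}" and k: "k \<in> {1..n}"
    and eq: "(one_line n p)[k - 1 := 0] = (one_line n q)[k - 1 := 0]"
  shows "p = q"
proof (rule permutes_eqI_off_point[OF p q, of k])
  fix i assume i: "i \<in> {1..n} - {k}"
  then have "k - 1 \<noteq> i - 1" using k by auto
  then have "one_line n p ! (i - 1) = one_line n q ! (i - 1)"
    using eq by (metis nth_list_update_neq)
  then show "p i = q i" using i by (metis DiffD1 one_line_nth)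
qed

text \<open>A strict minimum at \<open>k\<close> forces a descent at \<open>k - 1\<close> and an
  ascent at \<open>k\<close>, where these indices exist; intersecting with \<open>{1..}\<close>
  discards \<open>k - 1 = 0\<close>. Leaving \<open>a k\<close> free covers both the zeroed cycle
  and the permutation with value 1 at \<open>k\<close>.\<close>

lemma descents_eq_far_descents:
  assumes len: "length xs = n" and k: "k \<in> {1..n}"
    and far: "\<And>i. i \<in> {1..n} \<Longrightarrow> i \<noteq> k \<Longrightarrow> xs ! (i - 1) = a i \<and> xs ! (k - 1) < a i"
  shows "descents xs = far_descents n k a \<union> ({k - 1} \<inter> {1..})"
proof -
  have "i \<in> descents xs \<longleftrightarrow> i \<in> far_descents n k a \<union> ({k - 1} \<inter> {1..})" if i: "i \<in> {1..<n}" for i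
  proof -
    have d: "i \<in> descents xs \<longleftrightarrow> xs ! i < xs ! (i - 1)" using i len by (auto simp: descents_def)
    consider "i = k" | "Suc i = k" | "i \<noteq> k" "Suc i \<noteq> k" by blast
    then show ?thesis
    proof cases
      case 1
      then have "xs ! (k - 1) < xs ! i" using far[of "Suc i"] i by simp
      then show ?thesis using d 1 k by (auto simp: far_descents_def)
    next
      case 2
      then have "xs ! i < xs ! (i - 1)" using far[of i] i by auto
      then show ?thesis using d 2 i by auto
    next
      case 3
      then have "xs ! i = a (Suc i)" "xs ! (i - 1) = a i" using far[of i] far[of "Suc i"] i by auto
      then show ?thesis using d 3 i by (auto simp: far_descents_def)
    qed
  qed
  moreover have "descents xs \<subseteq> {1..<n}" "far_descents n k a \<union> ({k - 1} \<inter> {1..}) \<subseteq> {1..<n}"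
    using len k by (auto simp: descents_def far_descents_def)
  ultimately show ?thesis by blast
qed

lemma descents_zeroed_one_line:
  assumes p: "p permutes {1..n}" and k: "k \<in> {1..n}"
  shows "descents ((one_line n p)[k - 1 := 0]) = far_descents n k p \<union> ({k - 1} \<inter> {1..})"
proof (rule descents_eq_far_descents[OF _ k])
  fix i assume i: "i \<in> {1..n}" "i \<noteq> k"
  then have "k - 1 \<noteq> i - 1" using k by auto
  moreover have "p i \<in> {1..n}" using permutes_in_image[OF p] i by blast
  ultimately show "(one_line n p)[k - 1 := 0] ! (i - 1) = p i \<and> (one_line n p)[k - 1 := 0] ! (k - 1) < p i"
    using k one_line_nth[OF i(1), of p] by auto
qed simp

lemma descents_one_line_min:
  assumes s: "s permutes {1..n}" and k: "k \<in> {1..n}" and sk: "s k = 1"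
  shows "descents (one_line n s) = far_descents n k s \<union> ({k - 1} \<inter> {1..})"
proof (rule descents_eq_far_descents[OF _ k])
  fix i assume i: "i \<in> {1..n}" "i \<noteq> k"
  then have "s i \<noteq> s k" using permutes_inj[OF s] by (auto dest: injD)
  then have "s i > 1" using permutes_in_image[OF s, of i] i sk by auto
  then show "one_line n s ! (i - 1) = s i \<and> one_line n s ! (k - 1) < s i"
    using one_line_nth[OF i(1), of s] one_line_nth[OF k, of s] sk by simp
qed simp

text \<open>The root is recovered from \<open>s\<close> as \<open>inv s 1\<close>, the position of
  the value 1.\<close>

lemma bij_betw_rooted_sym_perms:
  assumes "n \<ge> 1"
  shows "bij_betw (\<lambda>(k, g). inv g) (SIGMA k:{1..n}. rooted n k) (sym_perms n)"
proof (rule bij_betwI[where g = "\<lambda>s. (inv s 1, inv s)"])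
  show "(\<lambda>(k, g). inv g) \<in> (SIGMA k:{1..n}. rooted n k) \<rightarrow> sym_perms n"
    by (auto simp: rooted_def sym_perms_def permutes_inv)
  show "(\<lambda>s. (inv s 1, inv s)) \<in> sym_perms n \<rightarrow> (SIGMA k:{1..n}. rooted n k)"
  proof
    fix s assume "s \<in> sym_perms n"
    then have i: "inv s permutes {1..n}" by (simp add: sym_perms_def permutes_inv)
    then show "(inv s 1, inv s) \<in> (SIGMA k:{1..n}. rooted n k)"
      using permutes_in_image[OF i, of 1] assms by (auto simp: rooted_def)
  qed
qed (auto simp: rooted_def sym_perms_def permutes_inv_inv)

text \<open>The zero reveals \<open>k\<close>, the remaining entries determine the cycle, and the
  cycle with its root determines \<open>g\<close>.\<close>

lemma bij_betw_rooted_zeroed_cycles: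
  "bij_betw (\<lambda>(k, g). (one_line n (cycle_of_enum n g))[k - 1 := 0])
    (SIGMA k:{1..n}. rooted n k) (zeroed_cycles n)"
proof (rule bij_betw_imageI)
  show "inj_on (\<lambda>(k, g). (one_line n (cycle_of_enum n g))[k - 1 := 0]) (SIGMA k:{1..n}. rooted n k)"
  proof (rule inj_onI, clarify)
    fix k g l h
    assume k: "k \<in> {1..n}" and g: "g \<in> rooted n k" and l: "l \<in> {1..n}" and h: "h \<in> rooted n l"
      and eq: "(one_line n (cycle_of_enum n g))[k - 1 := 0] = (one_line n (cycle_of_enum n h))[l - 1 := 0]"
    have p: "cycle_of_enum n g permutes {1..n}" "cycle_of_enum n h permutes {1..n}"
      using g h cycle_of_enum_permutes by (auto simp: rooted_def)
    have kl: "k = l"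
      using zeroed_one_line_nth_eq_0_iff[OF p(1) k k] zeroed_one_line_nth_eq_0_iff[OF p(2) l k] eq
      by simp
    have "cycle_of_enum n g = cycle_of_enum n h"
      using zeroed_one_line_inj[OF p k] eq kl by simp
    then show "k = l \<and> g = h" using inj_onD[OF inj_on_cycle_of_enum _ g] h kl by blast
  qed
  have "zeroed_cycles n = (\<Union>k\<in>{1..n}. (\<lambda>p. (one_line n p)[k - 1 := 0]) ` cyclic_perms n)"
    unfolding zeroed_cycles_def by blast
  also have "\<dots> = (\<Union>k\<in>{1..n}. (\<lambda>p. (one_line n p)[k - 1 := 0]) ` cycle_of_enum n ` rooted n k)"
    using cycle_of_enum_image by (intro SUP_cong) auto
  also have "\<dots> = (\<lambda>(k, g). (one_line n (cycle_of_enum n g))[k - 1 := 0]) ` (SIGMA k:{1..n}. rooted n k)"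
    by force
  finally show "(\<lambda>(k, g). (one_line n (cycle_of_enum n g))[k - 1 := 0]) ` (SIGMA k:{1..n}. rooted n k) = zeroed_cycles n"
    by simp
qed

theorem corollary4p3:
  fixes n :: nat
  assumes "n \<ge> 1"
  shows "\<exists>\<phi>. bij_betw \<phi> (zeroed_cycles n) (sym_perms n) \<and>
    (\<forall>\<tau> \<in> zeroed_cycles n. descents \<tau> = descents (one_line n (\<phi> \<tau>)) \<and>
      (\<forall>k \<in> {1..n}. \<tau> ! (k - 1) = 0 \<longrightarrow> \<phi> \<tau> k = 1))"
proof -
  define P where "P = (SIGMA k:{1..n}. rooted n k)"
  define Z where "Z = (\<lambda>(k, g). (one_line n (cycle_of_enum n g))[k - 1 := 0])"
  have "\<forall>k\<in>{1..n}. \<exists>\<psi>. bij_betw \<psi> (rooted n k) (rooted n k) \<and>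
    (\<forall>g\<in>rooted n k. far_descents n k (inv (\<psi> g)) = far_descents n k (cycle_of_enum n g))"
    using ex_bij_rooted by metis
  then obtain \<psi> where \<psi>: "\<And>k. k \<in> {1..n} \<Longrightarrow> bij_betw (\<psi> k) (rooted n k) (rooted n k)"
    "\<And>k g. k \<in> {1..n} \<Longrightarrow> g \<in> rooted n k \<Longrightarrow>
      far_descents n k (inv (\<psi> k g)) = far_descents n k (cycle_of_enum n g)"
    by metis
  \<comment> \<open>The matching acts separately for each root, which keeps \<open>k\<close>
    unchanged.\<close>
  define \<theta> where "\<theta> = (\<lambda>(k, g). (k, \<psi> k g))"
  have \<theta>: "bij_betw \<theta> P P"
  proof (rule bij_betw_imageI)
    show "inj_on \<theta> P"
      unfolding \<theta>_def P_def using \<psi>(1)[THEN bij_betw_imp_inj_on] by (force simp: inj_on_def)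
    have "\<theta> ` P = (SIGMA k:{1..n}. \<psi> k ` rooted n k)" by (force simp: \<theta>_def P_def)
    also have "\<dots> = P" unfolding P_def using \<psi>(1)[THEN bij_betw_imp_surj_on] by (intro Sigma_cong) auto
    finally show "\<theta> ` P = P" .
  qed
  have Z: "bij_betw Z P (zeroed_cycles n)"
    unfolding Z_def P_def by (rule bij_betw_rooted_zeroed_cycles)
  \<comment> \<open>Decode a zeroed cycle into its root and enumeration, apply the matching, then
    invert the new enumeration.\<close>
  define \<phi> where "\<phi> = (\<lambda>(k, g). inv g) \<circ> (\<theta> \<circ> inv_into P Z)"
  have bij: "bij_betw \<phi> (zeroed_cycles n) (sym_perms n)"
    unfolding \<phi>_def
    using bij_betw_trans[OF bij_betw_inv_into[OF Z] \<theta>] bij_betw_rooted_sym_perms[OF assms]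
    unfolding P_def by (rule bij_betw_trans)
  have "descents \<tau> = descents (one_line n (\<phi> \<tau>)) \<and>
      (\<forall>k \<in> {1..n}. \<tau> ! (k - 1) = 0 \<longrightarrow> \<phi> \<tau> k = 1)" if "\<tau> \<in> zeroed_cycles n" for \<tau>
  proof -
    obtain k g where k: "k \<in> {1..n}" and g: "g \<in> rooted n k" and \<tau>: "\<tau> = Z (k, g)"
      using bij_betw_imp_surj_on[OF Z] \<open>\<tau> \<in> _\<close> unfolding P_def by blast
    have "inv_into P Z \<tau> = (k, g)"
      unfolding \<tau> using k g by (intro inv_into_f_f bij_betw_imp_inj_on[OF Z]) (simp add: P_def)
    then have \<phi>: "\<phi> \<tau> = inv (\<psi> k g)" by (simp add: \<phi>_def \<theta>_def)
    have p: "cycle_of_enum n g permutes {1..n}"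
      using g cycle_of_enum_permutes by (auto simp: rooted_def)
    have "\<psi> k g \<in> rooted n k" using bij_betwE[OF \<psi>(1)[OF k]] g by blast
    then have q: "\<psi> k g permutes {1..n}" "\<psi> k g 1 = k" by (simp_all add: rooted_def)
    have inv1: "inv (\<psi> k g) k = 1" using permutes_inverses(2)[OF q(1), of 1] q(2) by simp
    have "descents \<tau> = far_descents n k (cycle_of_enum n g) \<union> ({k - 1} \<inter> {1..})"
      unfolding \<tau> Z_def using descents_zeroed_one_line[OF p k] by simp
    also have "\<dots> = descents (one_line n (\<phi> \<tau>))"
      unfolding \<phi> descents_one_line_min[OF permutes_inv[OF q(1)] k inv1] \<psi>(2)[OF k g] ..
    finally have "descents \<tau> = descents (one_line n (\<phi> \<tau>))" .
    moreover have "\<phi> \<tau> j = 1" if "j \<in> {1..n}" "\<tau> ! (j - 1) = 0" for j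
    proof -
      have "j = k" using that zeroed_one_line_nth_eq_0_iff[OF p k] by (simp add: \<tau> Z_def)
      then show ?thesis using \<phi> inv1 by simp
    qed
    ultimately show ?thesis by blast
  qed
  with bij show ?thesis by blast
qed

end
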